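(* Let $k\ge 1$ be a fixed integer. There is an algorithm that, given any tree $T$ with $n$ vertices, computes $\gamma_{1k}(T)$ in time linear in $n$, i.e. in $O(n)$ time.
   Context: A tree is a finite connected acyclic simple graph. A $k$-quasiperfect dominating set of a graph $G$ is a set $S$ of vertices such that every vertex not in $S$ is adjacent to at least one and at most $k$ vertices of $S$; $\gamma_{1k}(G)$ is the minimum cardinality of such a set. The tree is given as a rooted tree with vertices numbered $1,\dots,n$, root $1$, every non-root vertex having a number greater than that of its parent, stored as an array $\mathrm{Parent}[1\ldots n]$ in which each non-root vertex $i$ points to its parent. Running time counts elementary operations (array access, comparison and addition of integers bounded by $n$ or of the symbol $\infty$), each of unit cost. *)

theory Defs
  imports "HOL-Library.Extended_Nat" "HOL-Library.Landau_Symbols"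
begin

section \<open>Trees and quasiperfect domination\<close>

text \<open>A graph is given by its vertex set \<open>V\<close> and its set \<open>E\<close> of two-element edges.\<close>

definition simple_graph :: "'a set \<Rightarrow> 'a set set \<Rightarrow> bool" where
  "simple_graph V E \<longleftrightarrow> finite V \<and> (\<forall>e\<in>E. e \<subseteq> V \<and> card e = 2)"

definition is_path :: "'a set set \<Rightarrow> 'a \<Rightarrow> 'a list \<Rightarrow> 'a \<Rightarrow> bool" where
  "is_path E u xs v \<longleftrightarrow>
     xs \<noteq> [] \<and> hd xs = u \<and> last xs = v \<and> distinct xs \<and> successively (\<lambda>x y. {x, y} \<in> E) xs"

definition is_cycle :: "'a set set \<Rightarrow> 'a list \<Rightarrow> bool" where
  "is_cycle E xs \<longleftrightarrow>
     3 \<le> length xs \<and> distinct xs \<and> successively (\<lambda>x y. {x, y} \<in> E) xs \<and> {last xs, hd xs} \<in> E"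

definition connected_graph :: "'a set \<Rightarrow> 'a set set \<Rightarrow> bool" where
  "connected_graph V E \<longleftrightarrow> V \<noteq> {} \<and> (\<forall>u\<in>V. \<forall>v\<in>V. \<exists>xs. is_path E u xs v)"

definition acyclic_graph :: "'a set set \<Rightarrow> bool" where
  "acyclic_graph E \<longleftrightarrow> (\<nexists>xs. is_cycle E xs)"

definition tree :: "'a set \<Rightarrow> 'a set set \<Rightarrow> bool" where
  "tree V E \<longleftrightarrow> simple_graph V E \<and> connected_graph V E \<and> acyclic_graph E"

definition quasiperfect_dominating ::
    "nat \<Rightarrow> 'a set \<Rightarrow> 'a set set \<Rightarrow> 'a set \<Rightarrow> bool" where
  "quasiperfect_dominating k V E S \<longleftrightarrow>
     S \<subseteq> V \<and> (\<forall>v\<in>V - S. 1 \<le> card {u\<in>S. {u, v} \<in> E} \<and> card {u\<in>S. {u, v} \<in> E} \<le> k)"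

text \<open>For finite \<open>V\<close> the minimum is over a finite set, which is nonempty because it contains \<open>card V\<close>.\<close>

definition quasiperfect_domination_number :: "nat \<Rightarrow> 'a set \<Rightarrow> 'a set set \<Rightarrow> nat" where
  "quasiperfect_domination_number k V E = Min {card S | S. quasiperfect_dominating k V E S}"

definition is_parent :: "'a set set \<Rightarrow> 'a \<Rightarrow> 'a \<Rightarrow> 'a \<Rightarrow> bool" where
  "is_parent E r v p \<longleftrightarrow> (\<exists>xs. is_path E v (v # p # xs) r)"

text \<open>The tree on \<open>{1..n}\<close> with edge set \<open>E\<close> is rooted at \<open>1\<close>. The entry of the root is irrelevant.\<close>

definition parent_array :: "nat \<Rightarrow> nat set set \<Rightarrow> (nat \<Rightarrow> nat) \<Rightarrow> bool" where
  "parent_array n E Parent \<longleftrightarrow> (\<forall>i\<in>{2..n}. is_parent E 1 i (Parent i) \<and> Parent i < i)"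


section \<open>The machine model\<close>

text \<open>
  Algorithms are programs of a while language over finitely many registers and arrays, which are
  named by natural numbers. The cells hold natural numbers or \<open>\<infinity>\<close>. A program is a finite piece of
  syntax that does not depend on the input size \<open>n\<close>; the size enters the semantics only as the
  length of the arrays (indices \<open>1, \<dots>, n\<close>) and as the bound on the operands of arithmetic.
\<close>

datatype aexp = Const enat | Reg nat | Arr nat aexp | Plus aexp aexp

datatype bexp = Less aexp aexp | Leq aexp aexp

datatype com =
    Skip
  | Assign nat aexp
  | Store nat aexp aexp
  | Seq com com
  | If bexp com com
  | While bexp com

record store =
  reg :: "nat \<Rightarrow> enat"
  arr :: "nat \<Rightarrow> nat \<Rightarrow> enat"

definition bounded_value :: "nat \<Rightarrow> enat \<Rightarrow> bool" where
  "bounded_value n v \<longleftrightarrow> v \<le> enat n \<or> v = \<infinity>"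

definition valid_index :: "nat \<Rightarrow> enat \<Rightarrow> bool" where
  "valid_index n v \<longleftrightarrow> 1 \<le> v \<and> v \<le> enat n"

text \<open>
  Evaluation fails (\<open>None\<close>) when an array is accessed outside its range, or when an operand of an
  addition or a comparison is neither \<open>\<infinity>\<close> nor at most \<open>n\<close>.
\<close>

fun aval :: "nat \<Rightarrow> store \<Rightarrow> aexp \<Rightarrow> enat option" where
  "aval n s (Const c) = Some c"
| "aval n s (Reg x) = Some (reg s x)"
| "aval n s (Arr a e) =
     (case aval n s e of
        None \<Rightarrow> None
      | Some i \<Rightarrow> if valid_index n i then Some (arr s a (the_enat i)) else None)"
| "aval n s (Plus e1 e2) =
     (case (aval n s e1, aval n s e2) of
        (Some v, Some w) \<Rightarrow> if bounded_value n v \<and> bounded_value n w then Some (v + w) else None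
      | _ \<Rightarrow> None)"

fun bval :: "nat \<Rightarrow> store \<Rightarrow> bexp \<Rightarrow> bool option" where
  "bval n s (Less e1 e2) =
     (case (aval n s e1, aval n s e2) of
        (Some v, Some w) \<Rightarrow> if bounded_value n v \<and> bounded_value n w then Some (v < w) else None
      | _ \<Rightarrow> None)"
| "bval n s (Leq e1 e2) =
     (case (aval n s e1, aval n s e2) of
        (Some v, Some w) \<Rightarrow> if bounded_value n v \<and> bounded_value n w then Some (v \<le> w) else None
      | _ \<Rightarrow> None)"

text \<open>Every node of an expression costs one unit, including constants and register reads.\<close>

fun acost :: "aexp \<Rightarrow> nat" where
  "acost (Const c) = 1"
| "acost (Reg x) = 1"
| "acost (Arr a e) = acost e + 1"
| "acost (Plus e1 e2) = acost e1 + acost e2 + 1"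

fun bcost :: "bexp \<Rightarrow> nat" where
  "bcost (Less e1 e2) = acost e1 + acost e2 + 1"
| "bcost (Leq e1 e2) = acost e1 + acost e2 + 1"

text \<open>
  \<open>exec n P s t s'\<close>: started in \<open>s\<close>, the program \<open>P\<close> terminates without failure in \<open>s'\<close>,
  after \<open>t\<close> elementary operations.
\<close>

inductive exec :: "nat \<Rightarrow> com \<Rightarrow> store \<Rightarrow> nat \<Rightarrow> store \<Rightarrow> bool" for n :: nat where
  Skip: "exec n Skip s 1 s"
| Assign: "aval n s e = Some v \<Longrightarrow>
    exec n (Assign x e) s (acost e + 1) (s\<lparr>reg := (reg s)(x := v)\<rparr>)"
| Store: "aval n s e1 = Some i \<Longrightarrow> valid_index n i \<Longrightarrow> aval n s e2 = Some v \<Longrightarrow>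
    exec n (Store a e1 e2) s (acost e1 + acost e2 + 1)
      (s\<lparr>arr := (arr s)(a := (arr s a)(the_enat i := v))\<rparr>)"
| Seq: "exec n c1 s1 t1 s2 \<Longrightarrow> exec n c2 s2 t2 s3 \<Longrightarrow> exec n (Seq c1 c2) s1 (t1 + t2) s3"
| IfTrue: "bval n s b = Some True \<Longrightarrow> exec n c1 s t s' \<Longrightarrow>
    exec n (If b c1 c2) s (bcost b + t) s'"
| IfFalse: "bval n s b = Some False \<Longrightarrow> exec n c2 s t s' \<Longrightarrow>
    exec n (If b c1 c2) s (bcost b + t) s'"
| WhileFalse: "bval n s b = Some False \<Longrightarrow> exec n (While b c) s (bcost b) s"
| WhileTrue: "bval n s1 b = Some True \<Longrightarrow> exec n c s1 t1 s2 \<Longrightarrow> exec n (While b c) s2 t2 s3 \<Longrightarrow>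
    exec n (While b c) s1 (bcost b + t1 + t2) s3"

inductive_cases SkipE: "exec n Skip s t s'"
inductive_cases AssignE: "exec n (Assign x e) s t s'"
inductive_cases StoreE: "exec n (Store a e1 e2) s t s'"
inductive_cases SeqE: "exec n (Seq c1 c2) s t s'"
inductive_cases IfE: "exec n (If b c1 c2) s t s'"
inductive_cases WhileE: "exec n (While b c) s t s'"

lemma exec_deterministic:
  "exec n c s t s' \<Longrightarrow> exec n c s u s'' \<Longrightarrow> u = t \<and> s'' = s'"
proof (induction arbitrary: u s'' rule: exec.induct)
  case (Skip s)
  from Skip.prems show ?case by (rule SkipE) simp
next
  case (Assign s e v x)
  from Assign.prems show ?case by (rule AssignE) (simp add: Assign.hyps)
next
  case (Store s e1 i e2 v a)
  from Store.prems show ?case by (rule StoreE) (simp add: Store.hyps)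
next
  case (Seq c1 s1 t1 s2 c2 t2 s3)
  from Seq.prems show ?case by (rule SeqE) (metis Seq.IH)
next
  case (IfTrue s b c1 t s' c2)
  from IfTrue.prems show ?case by (rule IfE) (simp_all add: IfTrue.hyps IfTrue.IH)
next
  case (IfFalse s b c2 t s' c1)
  from IfFalse.prems show ?case by (rule IfE) (simp_all add: IfFalse.hyps IfFalse.IH)
next
  case (WhileFalse s b c)
  from WhileFalse.prems show ?case by (rule WhileE) (simp_all add: WhileFalse.hyps)
next
  case (WhileTrue s1 b c t1 s2 t2 s3)
  from WhileTrue.prems show ?case
  proof (rule WhileE)
    assume "bval n s1 b = Some False"
    then show ?thesis by (simp add: WhileTrue.hyps)
  next
    fix t1' s2' t2'
    assume *: "u = bcost b + t1' + t2'" "exec n c s1 t1' s2'" "exec n (While b c) s2' t2' s''"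
    from WhileTrue.IH(1)[OF *(2)] have "t1' = t1" "s2' = s2" by simp_all
    with WhileTrue.IH(2)[of t2' s''] * show ?thesis by simp
  qed
qed

text \<open>
  Input convention: register \<open>0\<close> holds \<open>n\<close> and array \<open>0\<close> holds \<open>Parent\<close>. All other cells have
  arbitrary initial contents. Output convention: the result is left in register \<open>0\<close>.
\<close>

definition input_store :: "nat \<Rightarrow> (nat \<Rightarrow> nat) \<Rightarrow> store \<Rightarrow> bool" where
  "input_store n Parent s \<longleftrightarrow> reg s 0 = enat n \<and> (\<forall>i\<in>{2..n}. arr s 0 i = enat (Parent i))"

definition result :: "store \<Rightarrow> enat" where
  "result s = reg s 0"

end

theory Submission
  imports Defs
begin

text \<open>
  The vertices are processed in the order \<open>n, \<dots>, 2\<close>; processing \<open>i\<close> adds the edge from \<open>i\<close> to its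
  parent to a forest that already contains the edges below. Every vertex carries a table with
  \<open>k + 2\<close> entries: the least cost of the part of the forest hanging from it, if it is selected, or
  if it is not selected and has exactly \<open>j \<le> k\<close> selected children so far. Adding an edge combines
  the table of the child with that of the parent in \<open>O(k)\<close> operations, after which the child
  is settled, because its children have larger numbers and were processed before. All finite sums
  that occur are sizes of subsets of \<open>{1..n}\<close>, so the arithmetic stays within the bounds of the machine.
\<close>

declare One_nat_def [simp del]

section \<open>Minima over extended naturals\<close>

lemma enat_Inf_mem:
  fixes A :: "enat set"
  assumes "A \<noteq> {}"
  shows "Inf A \<in> A"
  using assms by (auto simp: Inf_enat_def intro: LeastI)

text \<open>The extended naturals are well-ordered, so an infimum over a nonempty set is attained
  and adding \<open>c\<close> preserves the minimum; over the empty set both sides are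
  \<infinity>.\<close>

lemma enat_INF_add_left:
  fixes f :: "'a \<Rightarrow> enat"
  shows "(INF x\<in>A. c + f x) = c + (INF x\<in>A. f x)"
proof (cases "A = {}")
  case True
  then show ?thesis by (simp add: top_enat_def)
next
  case False
  show ?thesis
  proof (rule antisym)
    from False have "(INF x\<in>A. f x) \<in> f ` A" by (intro enat_Inf_mem) simp
    then obtain y where "y \<in> A" "(INF x\<in>A. f x) = f y" by auto
    then show "(INF x\<in>A. c + f x) \<le> c + (INF x\<in>A. f x)" by (auto intro: INF_lower2)
    show "c + (INF x\<in>A. f x) \<le> (INF x\<in>A. c + f x)"
      by (intro INF_greatest add_left_mono INF_lower)
  qed
qed

lemma INF_UNION:
  fixes f :: "'a \<Rightarrow> 'b :: complete_lattice"
  shows "(INF x\<in>\<Union>(B ` A). f x) = (INF y\<in>A. INF x\<in>B y. f x)"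
  by (rule antisym) (auto intro!: INF_greatest intro: INF_lower INF_lower2)

lemma INF_enat_card_eq_Min:
  assumes "finite \<A>" "\<A> \<noteq> {}"
  shows "(INF S\<in>\<A>. enat (card S)) = enat (Min (card ` \<A>))"
proof (rule antisym)
  from assms have "Min (card ` \<A>) \<in> card ` \<A>" by (intro Min_in) auto
  then obtain S where "S \<in> \<A>" "Min (card ` \<A>) = card S" by auto
  then show "(INF S\<in>\<A>. enat (card S)) \<le> enat (Min (card ` \<A>))" by (auto intro: INF_lower)
  show "enat (Min (card ` \<A>)) \<le> (INF S\<in>\<A>. enat (card S))"
    using assms by (intro INF_greatest) auto
qed

section \<open>The dynamic program\<close>

locale parent_function =
  fixes n k :: nat and p :: "nat \<Rightarrow> nat"
  assumes n_pos: "1 \<le> n"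
    and p_range: "\<And>i. i \<in> {2..n} \<Longrightarrow> 1 \<le> p i \<and> p i < i"
begin

text \<open>The threshold \<open>i\<close> marks a stage: the edges \<open>{c, p c}\<close> with
  \<open>i < c\<close> are the ones already added.\<close>

definition kids :: "nat \<Rightarrow> nat set \<Rightarrow> nat \<Rightarrow> nat" where
  "kids i S v = card {c \<in> S. i < c \<and> p c = v}"

text \<open>\<open>None\<close> means that \<open>v\<close> is selected, \<open>Some j\<close> that it is not and has \<open>j\<close> selected children above \<open>i\<close>.\<close>

definition status :: "nat \<Rightarrow> nat set \<Rightarrow> nat \<Rightarrow> nat option" where
  "status i S v = (if v \<in> S then None else Some (kids i S v))"

text \<open>Children exceed their parent, so \<open>kids u S u\<close> already counts all selected
  children of \<open>u\<close>. The guard \<open>2 \<le> u\<close> shields the root, whose entry in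
  \<open>p\<close> is arbitrary.\<close>

definition satisfied :: "nat set \<Rightarrow> nat \<Rightarrow> bool" where
  "satisfied S u \<longleftrightarrow>
     u \<in> S \<or> kids u S u + of_bool (2 \<le> u \<and> p u \<in> S) \<in> {1..k}"

text \<open>At stage \<open>i\<close> the vertices up to \<open>i\<close> are the roots of the
  forest and have a prescribed status; those above \<open>i\<close> have received all their edges
  and must be satisfied.\<close>

definition feasible :: "nat \<Rightarrow> (nat \<Rightarrow> nat option) \<Rightarrow> nat set set" where
  "feasible i x =
     {S. S \<subseteq> {1..n} \<and> (\<forall>v\<in>{1..i}. status i S v = x v) \<and> (\<forall>u\<in>{i<..n}. satisfied S u)}"

text \<open>
  The pairs of statuses of a parent and of its child that lead to status \<open>x\<close> of the parent once
  the edge between them is added, and for which the child is satisfied.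
\<close>

fun splits :: "nat option \<Rightarrow> (nat option \<times> nat option) set" where
  "splits None = Pair None ` insert None (Some ` {..<k})"
| "splits (Some j) =
     Pair (Some j) ` Some ` {1..k} \<union> (case j of 0 \<Rightarrow> {} | Suc l \<Rightarrow> {(Some l, None)})"

definition merge ::
    "(nat option \<Rightarrow> enat) \<Rightarrow> (nat option \<Rightarrow> enat) \<Rightarrow> nat option \<Rightarrow> enat" where
  "merge f g x = (INF (a, b)\<in>splits x. f a + g b)"

text \<open>
  Quantifying over the statuses of all roots at once makes it unnecessary to speak of the
  components of the forest formed by the edges \<open>{c, p c}\<close> with \<open>i < c\<close>.
\<close>

definition correct :: "nat \<Rightarrow> (nat \<Rightarrow> nat option \<Rightarrow> enat) \<Rightarrow> bool" where
  "correct i f \<longleftrightarrow>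
     (\<forall>x. (INF S\<in>feasible i x. enat (card S)) = (\<Sum>v=1..i. f v (x v)))"

text \<open>The parent's status is the same in all pairs, so its cost factors out. This leaves a
  minimum over the child alone, the form in which the program evaluates it.\<close>

lemma merge_None: "merge f g None = f None + min (g None) (INF l\<in>{..<k}. g (Some l))"
proof -
  have "merge f g None = (INF b\<in>insert None (Some ` {..<k}). f None + g b)"
    unfolding merge_def splits.simps image_image by simp
  also have "\<dots> = f None + (INF b\<in>insert None (Some ` {..<k}). g b)"
    by (rule enat_INF_add_left)
  finally show ?thesis by (simp add: image_image inf_min)
qed

lemma merge_Some:
  "merge f g (Some j) =
     min (f (Some j) + (INF l\<in>{1..k}. g (Some l)))
       (case j of 0 \<Rightarrow> \<infinity> | Suc l \<Rightarrow> f (Some l) + g None)"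
  unfolding merge_def splits.simps
  by (cases j) (simp_all add: INF_union image_image enat_INF_add_left inf_min top_enat_def min.commute)

section \<open>Adding one edge to the forest\<close>

lemma kids_pred:
  assumes "i \<in> {2..n}" "finite S"
  shows "kids (i - 1) S v = kids i S v + of_bool (p i = v \<and> i \<in> S)"
proof -
  have "{c \<in> S. i - 1 < c \<and> p c = v} =
      {c \<in> S. i < c \<and> p c = v} \<union> (if p i = v \<and> i \<in> S then {i} else {})"
    using assms by (auto simp: nat_less_le not_less intro: le_antisym)
  then show ?thesis using assms by (auto simp: kids_def)
qed

text \<open>All children of \<open>i\<close> have been counted. A selected parent adds one selected
  neighbour, which leaves room for at most \<open>k - 1\<close> selected children; without it,
  between 1 and \<open>k\<close> are required. A selected \<open>i\<close> is always satisfied and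
  raises the parent's count by one.\<close>

lemma splits_status:
  assumes i: "i \<in> {2..n}" and S: "finite S"
  shows "(status i S (p i), status i S i) \<in> splits y \<longleftrightarrow>
    status (i - 1) S (p i) = y \<and> satisfied S i"
  using i by (cases y) (auto simp: status_def satisfied_def kids_pred[OF i S] split: nat.split)

text \<open>The new edge turns \<open>i\<close> from a root into a settled vertex and can change the
  status of no remaining root but \<open>p i\<close>. The sets are therefore classified by the
  statuses of \<open>p i\<close> and \<open>i\<close> before the edge was added.\<close>

lemma feasible_step:
  assumes i: "i \<in> {2..n}"
  shows "feasible (i - 1) x = (\<Union>(a, b)\<in>splits (x (p i)). feasible i (x(p i := a, i := b)))"
proof (rule set_eqI)
  fix S
  from p_range[OF i] have pi: "1 \<le> p i" "p i < i" by auto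
  have roots: "{1..i} = insert i {1..i-1}" and below: "{i - 1<..n} = insert i {i<..n}"
    using i by auto
  show "S \<in> feasible (i - 1) x \<longleftrightarrow>
      S \<in> (\<Union>(a, b)\<in>splits (x (p i)). feasible i (x(p i := a, i := b)))"
  proof (cases "S \<subseteq> {1..n}")
    case False
    then show ?thesis by (auto simp: feasible_def)
  next
    case True
    then have S: "finite S" by (rule finite_subset) simp
    have same: "status (i - 1) S v = status i S v" if "v \<noteq> p i" for v
      using that by (simp add: status_def kids_pred[OF i S])
    \<comment> \<open>The pair \<open>(a, b)\<close> is forced: it consists of the statuses that
      \<open>S\<close> itself gives to \<open>p i\<close> and \<open>i\<close> at stage
      \<open>i\<close>.\<close>
    have "S \<in> (\<Union>(a, b)\<in>splits (x (p i)). feasible i (x(p i := a, i := b))) \<longleftrightarrow>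
        (status i S (p i), status i S i) \<in> splits (x (p i)) \<and>
        (\<forall>v\<in>{1..i-1} - {p i}. status i S v = x v) \<and> (\<forall>u\<in>{i<..n}. satisfied S u)"
      (is "?lhs \<longleftrightarrow> ?rhs")
    proof
      assume ?lhs
      then obtain a b where ab: "(a, b) \<in> splits (x (p i))"
        and st: "\<And>v. v \<in> {1..i} \<Longrightarrow> status i S v = (x(p i := a, i := b)) v"
        and sat: "\<forall>u\<in>{i<..n}. satisfied S u"
        by (auto simp: feasible_def)
      from st[of "p i"] st[of i] pi have "status i S (p i) = a" "status i S i = b" by auto
      moreover have "status i S v = x v" if "v \<in> {1..i-1} - {p i}" for v
        using st[of v] that by (auto split: if_splits)
      ultimately show ?rhs using ab sat by auto
    next
      assume ?rhs
      with True pi show ?lhs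
        by (intro UN_I[of "(status i S (p i), status i S i)"]) (auto simp: feasible_def roots)
    qed
    also have "\<dots> \<longleftrightarrow> status (i - 1) S (p i) = x (p i) \<and> satisfied S i \<and>
        (\<forall>v\<in>{1..i-1} - {p i}. status (i - 1) S v = x v) \<and> (\<forall>u\<in>{i<..n}. satisfied S u)"
      by (auto simp: splits_status[OF i S] same)
    also have "\<dots> \<longleftrightarrow> S \<in> feasible (i - 1) x"
    proof -
      have "{1..i-1} = insert (p i) ({1..i-1} - {p i})" using pi by auto
      then have "(\<forall>v\<in>{1..i-1}. status (i - 1) S v = x v) \<longleftrightarrow>
        status (i - 1) S (p i) = x (p i) \<and>
        (\<forall>v\<in>{1..i-1} - {p i}. status (i - 1) S v = x v)" by blast
      then show ?thesis using True by (auto simp: feasible_def below)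
    qed
    finally show ?thesis by simp
  qed
qed

lemma correct_step:
  assumes i: "i \<in> {2..n}" and f: "correct i f"
  shows "correct (i - 1) (f(p i := merge (f (p i)) (f i)))"
  unfolding correct_def
proof
  fix x
  from p_range[OF i] have pi: "1 \<le> p i" "p i < i" by auto
  \<comment> \<open>The roots that the new edge does not touch: their costs form a constant summand
    that can be pulled out of the infimum.\<close>
  define R where "R = {1..i-1} - {p i}"
  have roots: "{1..i-1} = insert (p i) R" "{1..i} = insert i (insert (p i) R)"
    and R: "finite R" "p i \<notin> R" "i \<notin> R"
    using pi by (auto simp: R_def)
  have rest: "(\<Sum>v=1..i. f v ((x(p i := a, i := b)) v)) =
      (\<Sum>v\<in>R. f v (x v)) + (f (p i) a + f i b)" for a b
  proof -
    have "(\<Sum>v\<in>R. f v ((x(p i := a, i := b)) v)) = (\<Sum>v\<in>R. f v (x v))"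
      using R by (intro sum.cong) auto
    then show ?thesis unfolding roots(2) using R pi by (simp add: ac_simps)
  qed
  have "(INF S\<in>feasible (i - 1) x. enat (card S)) =
      (INF (a, b)\<in>splits (x (p i)). INF S\<in>feasible i (x(p i := a, i := b)). enat (card S))"
    unfolding feasible_step[OF i] by (simp add: INF_UNION case_prod_beta)
  also have "\<dots> = (INF (a, b)\<in>splits (x (p i)). (\<Sum>v\<in>R. f v (x v)) + (f (p i) a + f i b))"
    using f unfolding correct_def by (simp only: rest)
  also have "\<dots> = (\<Sum>v\<in>R. f v (x v)) + merge (f (p i)) (f i) (x (p i))"
    by (simp add: case_prod_beta enat_INF_add_left merge_def)
  also have "\<dots> = (\<Sum>v=1..i-1. (f(p i := merge (f (p i)) (f i))) v (x v))"
  proof -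
    have "(\<Sum>v\<in>R. (f(p i := merge (f (p i)) (f i))) v (x v)) = (\<Sum>v\<in>R. f v (x v))"
      using R by (intro sum.cong) auto
    then show ?thesis unfolding roots(1) using R by (simp add: add.commute)
  qed
  finally show "(INF S\<in>feasible (i - 1) x. enat (card S)) =
      (\<Sum>v=1..i-1. (f(p i := merge (f (p i)) (f i))) v (x v))" .
qed

section \<open>Initial and final tables\<close>

text \<open>The table of an isolated vertex; \<infinity> marks the statuses it cannot have.\<close>

definition leaf :: "nat option \<Rightarrow> enat" where
  "leaf x = (case x of None \<Rightarrow> 1 | Some 0 \<Rightarrow> 0 | Some (Suc _) \<Rightarrow> \<infinity>)"

text \<open>Without edges every count is 0. If \<open>x\<close> uses only \<open>None\<close> and
  \<open>Some 0\<close>, exactly one set realises it; otherwise no set does, and both sides are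
  \<infinity>.\<close>

lemma correct_init: "correct n (\<lambda>_. leaf)"
  unfolding correct_def
proof
  fix x
  have kids: "kids n S v = 0" if "S \<subseteq> {1..n}" for S v
    using that by (auto simp: kids_def card_eq_0_iff)
  show "(INF S\<in>feasible n x. enat (card S)) = (\<Sum>v=1..n. leaf (x v))"
  proof (cases "\<forall>v\<in>{1..n}. x v \<in> {None, Some 0}")
    case True
    let ?S = "{v\<in>{1..n}. x v = None}"
    have "status n S v = x v \<longleftrightarrow> (v \<in> S \<longleftrightarrow> x v = None)"
      if "S \<subseteq> {1..n}" "v \<in> {1..n}" for S v
      using True that by (force simp: status_def kids)
    then have "feasible n x = {S. S \<subseteq> {1..n} \<and> (\<forall>v\<in>{1..n}. v \<in> S \<longleftrightarrow> x v = None)}"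
      by (auto simp: feasible_def)
    also have "\<dots> = {?S}" by auto
    finally have "feasible n x = {?S}" .
    moreover have "(\<Sum>v=1..n. leaf (x v)) = (\<Sum>v=1..n. if x v = None then 1 else 0)"
    proof (rule sum.cong)
      fix v
      assume "v \<in> {1..n}"
      with True have "x v = None \<or> x v = Some 0" by auto
      then show "leaf (x v) = (if x v = None then 1 else 0)" by (auto simp: leaf_def)
    qed simp
    moreover have "\<dots> = enat (card ?S)"
      by (subst sum.inter_filter[symmetric]) (auto simp: of_nat_eq_enat)
    ultimately show ?thesis by simp
  next
    case False
    then obtain v where v: "v \<in> {1..n}" "x v \<noteq> None" "x v \<noteq> Some 0" by auto
    have "status n S v \<noteq> x v" if "S \<subseteq> {1..n}" for S
      using v that by (auto simp: status_def kids)
    then have "feasible n x = {}" using v(1) unfolding feasible_def by blast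
    moreover from v have "leaf (x v) = \<infinity>"
      by (auto simp: leaf_def split: option.split nat.split)
    with v have "(\<Sum>v=1..n. leaf (x v)) = \<infinity>"
      by (subst sum.remove[of _ v]) auto
    ultimately show ?thesis by (simp add: top_enat_def)
  qed
qed

text \<open>Vertex 1 is the only root left and has no parent, so it is satisfied exactly if its
  status is \<open>None\<close> or \<open>Some l\<close> with \<open>l\<close> in
  \<open>{1..k}\<close>. The admissible sets are the union of the feasible sets for these
  statuses.\<close>

lemma correct_final:
  assumes "correct 1 f"
  shows "min (f 1 None) (INF l\<in>{1..k}. f 1 (Some l)) =
    (INF S\<in>{S. S \<subseteq> {1..n} \<and> (\<forall>u\<in>{1..n}. satisfied S u)}. enat (card S))"
proof -
  have "satisfied S 1 \<longleftrightarrow> status 1 S 1 \<in> insert None (Some ` {1..k})" for S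
    by (auto simp: satisfied_def status_def)
  moreover have "{1..n} = insert 1 {1<..n}" using n_pos by auto
  ultimately have "{S. S \<subseteq> {1..n} \<and> (\<forall>u\<in>{1..n}. satisfied S u)} =
      (\<Union>x\<in>insert None (Some ` {1..k}). feasible 1 (\<lambda>_. x))"
    unfolding feasible_def by auto
  then have "(INF S\<in>{S. S \<subseteq> {1..n} \<and> (\<forall>u\<in>{1..n}. satisfied S u)}. enat (card S)) =
      (INF x\<in>insert None (Some ` {1..k}). INF S\<in>feasible 1 (\<lambda>_. x). enat (card S))"
    by (simp only: INF_UNION)
  also have "\<dots> = (INF x\<in>insert None (Some ` {1..k}). f 1 x)"
    using assms by (simp add: correct_def)
  finally show ?thesis by (simp add: image_image inf_min)
qed

text \<open>Selecting every vertex is feasible, so the entries for selected vertices are finite.\<close>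

lemma correct_bounded_sum:
  assumes f: "correct i f" and "i \<le> n" and A: "A \<subseteq> {1..i}"
  shows "bounded_value n (\<Sum>v\<in>A. f v (x v))"
proof -
  have None: "f v None \<noteq> \<infinity>" if "v \<in> {1..i}" for v
  proof -
    have "{1..n} \<in> feasible i (\<lambda>_. None)"
      using \<open>i \<le> n\<close> by (auto simp: feasible_def status_def satisfied_def)
    then have "(INF S\<in>feasible i (\<lambda>_. None). enat (card S)) \<le> enat (card {1..n})"
      by (rule INF_lower)
    then have "(\<Sum>v=1..i. f v None) \<noteq> \<infinity>"
      using f by (auto simp: correct_def dest: enat_ile)
    then show ?thesis using that by (subst (asm) sum.remove[of _ v]) (auto simp: plus_eq_infty_iff_enat simp del: not_infinity_eq)
  qed
  \<comment> \<open>Completing the choice on \<open>A\<close> by \<open>None\<close> gives a sum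
    over all roots, which \<open>f\<close> being correct equates with the size of a set or with
    \<infinity>.\<close>
  let ?y = "\<lambda>v. if v \<in> A then x v else None"
  have split: "(\<Sum>v=1..i. f v (?y v)) = (\<Sum>v\<in>A. f v (x v)) + (\<Sum>v\<in>{1..i}-A. f v None)"
    using A by (subst sum.subset_diff[of A]) (auto intro!: arg_cong2[of _ _ _ _ "(+)"])
  show ?thesis
  proof (cases "feasible i ?y = {}")
    case True
    then have "(\<Sum>v=1..i. f v (?y v)) = \<infinity>"
      using spec[OF f[unfolded correct_def], of ?y] by (simp add: top_enat_def)
    \<comment> \<open>The added part is finite, so an infinite total must come from
      \<open>A\<close>.\<close>
    moreover have "(\<Sum>v\<in>{1..i}-A. f v None) \<noteq> \<infinity>"
    proof -
      have "(\<Sum>v\<in>B. f v None) \<noteq> \<infinity>" if "finite B" "B \<subseteq> {1..i}" for B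
        using that None
        by (induction B) (auto simp: plus_eq_infty_iff_enat simp del: not_infinity_eq)
      then show ?thesis by auto
    qed
    ultimately have "(\<Sum>v\<in>A. f v (x v)) = \<infinity>"
      unfolding split by (metis plus_eq_infty_iff_enat)
    then show ?thesis by (simp add: bounded_value_def)
  next
    case False
    then obtain S where S: "S \<in> feasible i ?y" by auto
    then have "card S \<le> n"
      using card_mono[of "{1..n}" S] by (auto simp: feasible_def)
    moreover from S have "(INF S\<in>feasible i ?y. enat (card S)) \<le> enat (card S)" by (rule INF_lower)
    ultimately have "(\<Sum>v=1..i. f v (?y v)) \<le> enat n"
      using f by (auto simp: correct_def intro: order_trans)
    then have "(\<Sum>v\<in>A. f v (x v)) \<le> enat n"
      unfolding split by (metis le_iff_add order_trans)
    then show ?thesis by (simp add: bounded_value_def)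
  qed
qed

lemma correct_bounded:
  assumes "correct i f" "i \<le> n" "v \<in> {1..i}"
  shows "bounded_value n (f v a)"
  using correct_bounded_sum[OF assms(1,2), of "{v}" "\<lambda>_. a"] assms(3) by simp

lemma correct_bounded_add:
  assumes "correct i f" "i \<le> n" "u \<in> {1..i}" "v \<in> {1..i}" "u \<noteq> v"
  shows "bounded_value n (f u a + f v b)"
  using correct_bounded_sum[OF assms(1,2), of "{u, v}" "\<lambda>w. if w = u then a else b"] assms(3-5)
  by simp

section \<open>From satisfied vertices to quasiperfect domination\<close>

text \<open>The neighbours of \<open>u\<close> are its children, which are larger, and its parent,
  which is smaller, so nothing is counted twice.\<close>

lemma degree_eq:
  assumes E: "E = (\<lambda>i. {i, p i}) ` {2..n}" and S: "S \<subseteq> {1..n}" and u: "u \<in> {1..n}"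
  shows "card {w \<in> S. {w, u} \<in> E} = kids u S u + of_bool (2 \<le> u \<and> p u \<in> S)"
proof -
  have "finite S" using S by (rule finite_subset) simp
  have "{w, u} \<in> E \<longleftrightarrow> u < w \<and> p w = u \<or> 2 \<le> u \<and> w = p u" if "w \<in> S" for w
    using that S u p_range unfolding E by (fastforce simp: doubleton_eq_iff)
  then have "{w \<in> S. {w, u} \<in> E} =
      {w \<in> S. u < w \<and> p w = u} \<union> (if 2 \<le> u \<and> p u \<in> S then {p u} else {})"
    by auto
  moreover have "p u < u" if "2 \<le> u" using p_range[of u] u that by auto
  ultimately show ?thesis using \<open>finite S\<close> by (auto simp: kids_def)
qed

lemma quasiperfect_dominating_iff:
  assumes E: "E = (\<lambda>i. {i, p i}) ` {2..n}"
  shows "quasiperfect_dominating k {1..n} E S \<longleftrightarrow>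
    S \<subseteq> {1..n} \<and> (\<forall>u\<in>{1..n}. satisfied S u)"
proof (cases "S \<subseteq> {1..n}")
  case True
  have "satisfied S u \<longleftrightarrow> u \<in> S \<or> card {w \<in> S. {w, u} \<in> E} \<in> {1..k}" if "u \<in> {1..n}" for u
    using degree_eq[OF E True that] by (simp add: satisfied_def)
  then show ?thesis using True by (auto simp: quasiperfect_dominating_def)
qed (simp add: quasiperfect_dominating_def)

lemma quasiperfect_domination_number_eq:
  assumes E: "E = (\<lambda>i. {i, p i}) ` {2..n}" and f: "correct 1 f"
  shows "enat (quasiperfect_domination_number k {1..n} E) =
    min (f 1 None) (INF l\<in>{1..k}. f 1 (Some l))"
proof -
  let ?A = "{S. S \<subseteq> {1..n} \<and> (\<forall>u\<in>{1..n}. satisfied S u)}"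
  have "{1..n} \<in> ?A" by (auto simp: satisfied_def)
  then have "(INF S\<in>?A. enat (card S)) = enat (Min (card ` ?A))"
    by (intro INF_enat_card_eq_Min) (auto intro: finite_subset[of _ "Pow {1..n}"])
  moreover have "card ` ?A = {card S | S. quasiperfect_dominating k {1..n} E S}"
    by (auto simp: quasiperfect_dominating_iff[OF E])
  ultimately show ?thesis
    unfolding correct_final[OF f] quasiperfect_domination_number_def by simp
qed

end

section \<open>Edges of a tree given by its parent array\<close>

text \<open>The larger endpoint is replaced by its parent, which decreases \<open>u + v\<close>. The
  bound on the vertices shows that this endpoint does not lie on the shorter path, so attaching it
  keeps the path simple.\<close>

lemma parent_edges_path:
  fixes p :: "nat \<Rightarrow> nat"
  assumes p: "\<And>i. i \<in> {2..n} \<Longrightarrow> 1 \<le> p i \<and> p i < i"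
    and "u \<in> {1..n}" "v \<in> {1..n}"
  shows "\<exists>xs. is_path ((\<lambda>i. {i, p i}) ` {2..n}) u xs v \<and> (\<forall>x\<in>set xs. x \<le> max u v)"
  using assms(2,3)
proof (induction "u + v" arbitrary: u v rule: less_induct)
  case less
  let ?F = "(\<lambda>i. {i, p i}) ` {2..n}"
  consider "u = v" | "v < u" | "u < v" by linarith
  then show ?case
  proof cases
    case 1
    then show ?thesis by (intro exI[of _ "[u]"]) (auto simp: is_path_def)
  next
    case 2
    with less.prems have u: "u \<in> {2..n}" by auto
    with less.hyps[of "p u" v] p[OF u] less.prems obtain xs
      where xs: "is_path ?F (p u) xs v" "\<forall>x\<in>set xs. x \<le> max (p u) v" by auto
    have "is_path ?F u (u # xs) v"
      using xs u p[OF u] 2 by (fastforce simp: is_path_def successively_Cons)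
    then show ?thesis using xs(2) 2 p[OF u] by (intro exI[of _ "u # xs"]) fastforce
  next
    case 3
    with less.prems have v: "v \<in> {2..n}" by auto
    with less.hyps[of u "p v"] p[OF v] less.prems obtain xs
      where xs: "is_path ?F u xs (p v)" "\<forall>x\<in>set xs. x \<le> max u (p v)" by auto
    have "{p v, v} \<in> ?F" using v by (auto simp: insert_commute)
    then have "is_path ?F u (xs @ [v]) v"
      using xs v p[OF v] 3 by (fastforce simp: is_path_def successively_append_iff)
    then show ?thesis using xs(2) 3 p[OF v] by (intro exI[of _ "xs @ [v]"]) fastforce
  qed
qed

text \<open>The parent edges alone already connect any two vertices, so any further edge of the tree
  would close a cycle.\<close>

lemma tree_edges_eq:
  assumes tree: "tree {1..n} E" and par: "parent_array n E p"
  shows "\<forall>i\<in>{2..n}. 1 \<le> p i \<and> p i < i" and "E = (\<lambda>i. {i, p i}) ` {2..n}"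
proof -
  let ?F = "(\<lambda>i. {i, p i}) ` {2..n}"
  have E: "e \<subseteq> {1..n}" "card e = 2" if "e \<in> E" for e
    using tree that by (auto simp: tree_def simple_graph_def)
  have edge: "{i, p i} \<in> E" if "i \<in> {2..n}" for i
    using par that by (auto simp: parent_array_def is_parent_def is_path_def)
  then have FE: "?F \<subseteq> E" by auto
  show p: "\<forall>i\<in>{2..n}. 1 \<le> p i \<and> p i < i"
    using E(1)[OF edge] par by (auto simp: parent_array_def)
  have down: "{u, v} \<in> ?F" if uv: "{u, v} \<in> E" "v < u" for u v
  proof (rule ccontr)
    assume not: "{u, v} \<notin> ?F"
    from E(1)[OF uv(1)] have "u \<in> {1..n}" "v \<in> {1..n}" by auto
    with parent_edges_path[of n p u v] p obtain xs where xs: "is_path ?F u xs v" by auto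
    \<comment> \<open>A shorter path could only be \<open>[u, v]\<close>, which would make
      \<open>{u, v}\<close> a parent edge.\<close>
    have "3 \<le> length xs"
    proof (rule ccontr)
      assume "\<not> 3 \<le> length xs"
      with xs uv have "xs = [u, v]"
        by (auto simp: is_path_def not_le less_Suc_eq numeral_3_eq_3 length_Suc_conv)
      with xs not show False by (simp add: is_path_def)
    qed
    moreover have "successively (\<lambda>x y. {x, y} \<in> E) xs"
      using xs FE successively_mono[of "\<lambda>x y. {x, y} \<in> ?F" xs "\<lambda>x y. {x, y} \<in> E"]
      unfolding is_path_def by blast
    moreover have "{last xs, hd xs} \<in> E"
      using xs uv(1) unfolding is_path_def by (simp add: insert_commute)
    ultimately have "is_cycle E xs"
      using xs unfolding is_cycle_def is_path_def by blast
    with tree show False by (auto simp: tree_def acyclic_graph_def)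
  qed
  have "E \<subseteq> ?F"
  proof
    fix e
    assume e: "e \<in> E"
    then obtain u v where uv: "e = {u, v}" "u \<noteq> v" using E(2)[OF e] by (auto simp: card_2_iff)
    then consider "v < u" | "u < v" by linarith
    then show "e \<in> ?F"
      using down[of u v] down[of v u] e uv by cases (simp_all add: insert_commute)
  qed
  with FE show "E = ?F" by auto
qed

section \<open>Reasoning about programs\<close>

text \<open>Total correctness, including absence of failure. Time is left out because the loop-free
  pieces receive a syntactic bound from \<open>max_cost\<close>.\<close>

definition wp :: "nat \<Rightarrow> com \<Rightarrow> store \<Rightarrow> (store \<Rightarrow> bool) \<Rightarrow> bool" where
  "wp n c s Q \<longleftrightarrow> (\<exists>t s'. exec n c s t s' \<and> Q s')"

lemma wp_Skip: "Q s \<Longrightarrow> wp n Skip s Q"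
  unfolding wp_def by (blast intro: exec.Skip)

lemma wp_Assign: "aval n s e = Some v \<Longrightarrow> Q (s\<lparr>reg := (reg s)(x := v)\<rparr>) \<Longrightarrow> wp n (Assign x e) s Q"
  unfolding wp_def by (blast intro: exec.Assign)

lemma wp_Store:
  "aval n s e1 = Some i \<Longrightarrow> valid_index n i \<Longrightarrow> aval n s e2 = Some v \<Longrightarrow>
    Q (s\<lparr>arr := (arr s)(a := (arr s a)(the_enat i := v))\<rparr>) \<Longrightarrow> wp n (Store a e1 e2) s Q"
  unfolding wp_def by (blast intro: exec.Store)

lemma wp_Seq: "wp n c1 s (\<lambda>s. wp n c2 s Q) \<Longrightarrow> wp n (Seq c1 c2) s Q"
  unfolding wp_def by (blast intro: exec.Seq)

lemma wp_If: "bval n s b = Some B \<Longrightarrow> wp n (if B then c1 else c2) s Q \<Longrightarrow> wp n (If b c1 c2) s Q"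
  unfolding wp_def by (cases B) (auto intro: exec.IfTrue exec.IfFalse)

fun loop_free :: "com \<Rightarrow> bool" where
  "loop_free (Seq c1 c2) = (loop_free c1 \<and> loop_free c2)"
| "loop_free (If b c1 c2) = (loop_free c1 \<and> loop_free c2)"
| "loop_free (While b c) = False"
| "loop_free _ = True"

text \<open>The bound depends on the program text alone, hence is constant in \<open>n\<close>. The
  value 0 for loops is a placeholder; the bound is claimed only for \<open>loop_free\<close>
  programs.\<close>

fun max_cost :: "com \<Rightarrow> nat" where
  "max_cost Skip = 1"
| "max_cost (Assign x e) = acost e + 1"
| "max_cost (Store a e1 e2) = acost e1 + acost e2 + 1"
| "max_cost (Seq c1 c2) = max_cost c1 + max_cost c2"
| "max_cost (If b c1 c2) = bcost b + max (max_cost c1) (max_cost c2)"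
| "max_cost (While b c) = 0"

lemma exec_le_max_cost: "exec n c s t s' \<Longrightarrow> loop_free c \<Longrightarrow> t \<le> max_cost c"
  by (induction rule: exec.induct) auto

lemma wp_loop_free_cost:
  assumes "wp n c s Q" "loop_free c"
  shows "\<exists>t s'. exec n c s t s' \<and> t \<le> max_cost c \<and> Q s'"
  using assms exec_le_max_cost unfolding wp_def by blast

text \<open>The measure \<open>m\<close> is the exact number of iterations left. Each costs one
  guard test and at most \<open>max_cost c\<close>; the extra \<open>bcost b\<close> is the failing
  last test.\<close>

lemma exec_While_cost:
  assumes c: "loop_free c"
    and guard: "\<And>s. I s \<Longrightarrow> bval n s b = Some (0 < m s)"
    and body: "\<And>s. I s \<Longrightarrow> 0 < m s \<Longrightarrow> wp n c s (\<lambda>s'. I s' \<and> m s = Suc (m s'))"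
    and "I s"
  shows "\<exists>t s'. exec n (While b c) s t s' \<and> t \<le> bcost b + m s * (bcost b + max_cost c) \<and>
    I s' \<and> m s' = 0"
  using \<open>I s\<close>
proof (induction "m s" arbitrary: s)
  case 0
  then have "exec n (While b c) s (bcost b) s" using guard[of s] by (auto intro: exec.WhileFalse)
  then show ?case using 0 by fastforce
next
  case (Suc l)
  from Suc.hyps(2) body[OF Suc.prems] have "wp n c s (\<lambda>s'. I s' \<and> m s = Suc (m s'))" by simp
  from wp_loop_free_cost[OF this c] obtain t1 s1
    where 1: "exec n c s t1 s1" "t1 \<le> max_cost c" "I s1" "m s = Suc (m s1)" by blast
  from Suc.hyps(1)[of s1] Suc.hyps(2) 1 obtain t2 s2
    where 2: "exec n (While b c) s1 t2 s2" "t2 \<le> bcost b + m s1 * (bcost b + max_cost c)"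
      "I s2" "m s2 = 0" by auto
  have "exec n (While b c) s (bcost b + t1 + t2) s2"
    using guard[OF Suc.prems] Suc.hyps(2) 1 2 by (auto intro: exec.WhileTrue)
  then show ?case using 1 2 by (intro exI[of _ "bcost b + t1 + t2"] exI[of _ s2]) simp
qed

lemma bounded_value_enat [simp]: "bounded_value n (enat i) \<longleftrightarrow> i \<le> n"
  by (simp add: bounded_value_def)

lemma bounded_value_1 [simp]: "bounded_value n 1 \<longleftrightarrow> 1 \<le> n"
  by (simp add: one_enat_def)

lemma bounded_value_infinity [simp]: "bounded_value n \<infinity>"
  by (simp add: bounded_value_def)

lemma bounded_value_min: "bounded_value n x \<Longrightarrow> bounded_value n y \<Longrightarrow> bounded_value n (min x y)"
  by (simp add: min_def)

lemma bounded_value_INF: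
  assumes "\<And>l. l \<in> A \<Longrightarrow> bounded_value n (f l)"
  shows "bounded_value n (INF l\<in>A. f l)"
proof (cases "A = {}")
  case False
  then have "(INF l\<in>A. f l) \<in> f ` A" by (intro enat_Inf_mem) simp
  then show ?thesis using assms by auto
qed (simp add: top_enat_def)

lemma valid_index_enat [simp]: "valid_index n (enat i) \<longleftrightarrow> i \<in> {1..n}"
  by (simp add: valid_index_def one_enat_def)

section \<open>The program\<close>

text \<open>
  Array \<open>1\<close> holds the predecessors of the indices, since the machine cannot subtract. Array \<open>2\<close>
  holds the table entries for \<open>None\<close> and array \<open>3 + j\<close> those for \<open>Some j\<close>. The current vertex is in
  register \<open>1\<close>, its parent in register \<open>4\<close>.
\<close>

fun min_prog :: "nat \<Rightarrow> nat list \<Rightarrow> com" where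
  "min_prog r [] = Skip"
| "min_prog r (l # ls) =
     Seq (If (Less (Arr (3 + l) (Reg 1)) (Reg r)) (Assign r (Arr (3 + l) (Reg 1))) Skip)
       (min_prog r ls)"

text \<open>Array \<open>4 + j\<close> belongs to \<open>Some (Suc j)\<close>, so the entry for
  \<open>Some 0\<close> is spared.\<close>

fun unselected_prog :: "nat \<Rightarrow> com" where
  "unselected_prog 0 = Skip"
| "unselected_prog (Suc j) =
     Seq (Store (4 + j) (Reg 1) (Const \<infinity>)) (unselected_prog j)"

definition leaf_prog :: "nat \<Rightarrow> com" where
  "leaf_prog k =
     Seq (Store 2 (Reg 1) (Const 1)) (Seq (Store 3 (Reg 1) (Const 0)) (unselected_prog k))"

text \<open>Updating in decreasing order of \<open>j\<close>, since the new entry for \<open>Suc j\<close> needs the old one for \<open>j\<close>.\<close>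

fun merge_loop :: "nat \<Rightarrow> com" where
  "merge_loop 0 = Skip"
| "merge_loop (Suc j) =
     Seq (Assign 5 (Plus (Arr (4 + j) (Reg 4)) (Reg 2)))
    (Seq (Assign 6 (Plus (Arr (3 + j) (Reg 4)) (Arr 2 (Reg 1))))
    (Seq (If (Less (Reg 5) (Reg 6)) (Store (4 + j) (Reg 4) (Reg 5)) (Store (4 + j) (Reg 4) (Reg 6)))
       (merge_loop j)))"

text \<open>Register 2 receives the best cost of an unselected child satisfied without its parent,
  register 3 that of a child whose parent is selected. The parent's entry for \<open>Some 0\<close>
  is updated only after \<open>merge_loop\<close>, which still reads its old value.\<close>

definition merge_prog :: "nat \<Rightarrow> com" where
  "merge_prog k =
     Seq (Assign 4 (Arr 0 (Reg 1)))
    (Seq (Assign 2 (Const \<infinity>))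
    (Seq (min_prog 2 [1..<Suc k])
    (Seq (Assign 3 (Arr 2 (Reg 1)))
    (Seq (min_prog 3 [0..<k])
    (Seq (merge_loop k)
    (Seq (Store 3 (Reg 4) (Plus (Arr 3 (Reg 4)) (Reg 2)))
    (Seq (Store 2 (Reg 4) (Plus (Arr 2 (Reg 4)) (Reg 3)))
         (Assign 1 (Arr 1 (Reg 1))))))))))"

definition init_step :: "nat \<Rightarrow> com" where
  "init_step k =
     Seq (Store 1 (Plus (Reg 1) (Const 1)) (Reg 1))
    (Seq (Assign 1 (Plus (Reg 1) (Const 1))) (leaf_prog k))"

text \<open>The first loop counts up and fills the tables, the second counts down and merges. The
  final minimum skips array 3, the status \<open>Some 0\<close>, since the root has no parent to
  dominate it.\<close>

definition qpd_prog :: "nat \<Rightarrow> com" where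
  "qpd_prog k =
     Seq (Seq (Assign 1 (Const 1)) (leaf_prog k))
    (Seq (While (Less (Reg 1) (Reg 0)) (init_step k))
    (Seq (While (Less (Const 1) (Reg 1)) (merge_prog k))
         (Seq (Assign 0 (Arr 2 (Reg 1))) (min_prog 0 [1..<Suc k]))))"

lemma loop_free_progs [simp]:
  "loop_free (min_prog r ls)" "loop_free (unselected_prog j)" "loop_free (merge_loop j)"
  "loop_free (leaf_prog k)" "loop_free (merge_prog k)" "loop_free (init_step k)"
proof -
  show *: "loop_free (min_prog r ls)" for r ls by (induction ls) auto
  show **: "loop_free (unselected_prog j)" for j by (induction j) auto
  show ***: "loop_free (merge_loop j)" by (induction j) auto
  have "loop_free (merge_loop j)" for j by (induction j) auto
  with * ** show "loop_free (leaf_prog k)" "loop_free (merge_prog k)" "loop_free (init_step k)"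
    by (simp_all add: leaf_prog_def merge_prog_def init_step_def)
qed

section \<open>Correctness of the loop-free pieces\<close>

lemma wp_min_prog:
  assumes "reg s 1 = enat v" "v \<in> {1..n}" "r \<noteq> 1"
    and "\<And>l. l \<in> set ls \<Longrightarrow> bounded_value n (arr s (3 + l) v)"
    and "bounded_value n (reg s r)"
    and "\<And>s'. arr s' = arr s \<Longrightarrow>
      reg s' = (reg s)(r := min (reg s r) (INF l\<in>set ls. arr s (3 + l) v)) \<Longrightarrow> Q s'"
  shows "wp n (min_prog r ls) s Q"
  using assms
proof (induction ls arbitrary: s)
  case Nil
  then show ?case by (auto intro!: wp_Skip simp: top_enat_def)
next
  case (Cons l ls)
  let ?s = "s\<lparr>reg := (reg s)(r := min (reg s r) (arr s (3 + l) v))\<rparr>"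
  have "wp n (min_prog r ls) ?s Q"
  proof (rule Cons.IH)
    fix s' :: store
    assume "arr s' = arr ?s"
      "reg s' = (reg ?s)(r := min (reg ?s r) (INF l\<in>set ls. arr ?s (3 + l) v))"
    then show "Q s'" by (intro Cons.prems(6)) (auto simp: inf_min min.assoc)
  qed (use Cons.prems in \<open>auto intro: bounded_value_min\<close>)
  then show ?case
    using Cons.prems(1-5)
    by (cases "arr s (3 + l) v < reg s r")
      (auto intro!: wp_Seq wp_If wp_Skip wp_Assign simp: min_absorb1 min_absorb2 not_less)
qed

lemma wp_unselected_prog:
  assumes "reg s 1 = enat v" "v \<in> {1..n}"
    and "\<And>s'. reg s' = reg s \<Longrightarrow>
      (\<And>a. arr s' a = (if a \<in> {4..<4 + j} then (arr s a)(v := \<infinity>) else arr s a)) \<Longrightarrow> Q s'"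
  shows "wp n (unselected_prog j) s Q"
  using assms
proof (induction j arbitrary: s)
  case 0
  then show ?case by (auto intro!: wp_Skip)
next
  case (Suc j)
  let ?s = "s\<lparr>arr := (arr s)(4 + j := (arr s (4 + j))(v := \<infinity>))\<rparr>"
  have "wp n (unselected_prog j) ?s Q"
  proof (rule Suc.IH)
    fix s' :: store
    assume "reg s' = reg ?s"
      and "\<And>a. arr s' a = (if a \<in> {4..<4 + j} then (arr ?s a)(v := \<infinity>) else arr ?s a)"
    then show "Q s'" by (intro Suc.prems(3)) auto
  qed (use Suc.prems in auto)
  then show ?case using Suc.prems(1,2) by (auto intro!: wp_Seq wp_Store)
qed

lemma wp_leaf_prog:
  assumes "reg s 1 = enat v" "v \<in> {1..n}"
    and "\<And>s'. reg s' = reg s \<Longrightarrow>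
      (\<And>a. arr s' a =
        (if a = 2 then (arr s a)(v := 1)
         else if a = 3 then (arr s a)(v := 0)
         else if a \<in> {4..<4 + k} then (arr s a)(v := \<infinity>) else arr s a)) \<Longrightarrow> Q s'"
  shows "wp n (leaf_prog k) s Q"
  using assms(1,2) unfolding leaf_prog_def
  by (auto intro!: wp_Seq wp_Store wp_unselected_prog assms(3))

text \<open>The effect is expressed through the initial store alone: with decreasing indices, the
  parent's entries that remain to be read have not been overwritten.\<close>

lemma wp_merge_loop:
  assumes "reg s 1 = enat i" "i \<in> {1..n}" "reg s 4 = enat v" "v \<in> {1..n}" "i \<noteq> v"
    and "bounded_value n (reg s 2)" "bounded_value n (arr s 2 i)"
    and "\<And>l. l \<le> j \<Longrightarrow> bounded_value n (arr s (3 + l) v)"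
    and "\<And>l. l \<le> j \<Longrightarrow> bounded_value n (arr s (3 + l) v + reg s 2)"
    and "\<And>l. l \<le> j \<Longrightarrow> bounded_value n (arr s (3 + l) v + arr s 2 i)"
    and "\<And>s'. (\<And>r. r \<notin> {5, 6} \<Longrightarrow> reg s' r = reg s r) \<Longrightarrow>
      (\<And>a. arr s' a =
        (if a \<in> {4..<4 + j}
         then (arr s a)(v := min (arr s a v + reg s 2) (arr s (a - 1) v + arr s 2 i))
         else arr s a)) \<Longrightarrow> Q s'"
  shows "wp n (merge_loop j) s Q"
  using assms
proof (induction j arbitrary: s)
  case 0
  then show ?case by (auto intro!: wp_Skip)
next
  case (Suc j)
  let ?x = "arr s (4 + j) v + reg s 2" and ?y = "arr s (3 + j) v + arr s 2 i"
  let ?s = "s\<lparr>reg := (reg s)(5 := ?x, 6 := ?y), arr := (arr s)(4 + j := (arr s (4 + j))(v := min ?x ?y))\<rparr>"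
  have "3 + Suc j = 4 + j" by simp
  then have b: "bounded_value n (arr s (4 + j) v)" "bounded_value n ?x"
    "bounded_value n (arr s (3 + j) v)" "bounded_value n ?y"
    using Suc.prems(8,9)[of "Suc j"] Suc.prems(8,10)[of j] by simp_all
  have "wp n (merge_loop j) ?s Q"
  proof (rule Suc.IH)
    fix s' :: store
    assume reg: "\<And>r. r \<notin> {5, 6} \<Longrightarrow> reg s' r = reg ?s r"
      and arr: "\<And>a. arr s' a =
        (if a \<in> {4..<4 + j}
         then (arr ?s a)(v := min (arr ?s a v + reg ?s 2) (arr ?s (a - 1) v + arr ?s 2 i))
         else arr ?s a)"
    show "Q s'"
    proof (rule Suc.prems(11))
      show "reg s' r = reg s r" if "r \<notin> {5, 6}" for r
        using reg[OF that] that by simp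
      fix a
      consider "a \<in> {4..<4 + j}" | "a = 4 + j" | "a < 4 \<or> 4 + j < a" by fastforce
      then show "arr s' a =
        (if a \<in> {4..<4 + Suc j}
         then (arr s a)(v := min (arr s a v + reg s 2) (arr s (a - 1) v + arr s 2 i))
         else arr s a)"
        by cases (auto simp: arr)
    qed
  qed (use Suc.prems(1-7) Suc.prems(8-10) in simp_all)
  then have "wp n
      (If (Less (Reg 5) (Reg 6)) (Store (4 + j) (Reg 4) (Reg 5)) (Store (4 + j) (Reg 4) (Reg 6)))
      (s\<lparr>reg := (reg s)(5 := ?x, 6 := ?y)\<rparr>) (\<lambda>s. wp n (merge_loop j) s Q)"
    using Suc.prems(3,4) b(2,4)
    by (cases "?x < ?y")
      (auto intro!: wp_If[where B = "?x < ?y"] wp_Store simp: min_absorb1 min_absorb2 not_less)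
  moreover have "aval n s (Plus (Arr (4 + j) (Reg 4)) (Reg 2)) = Some ?x"
    "aval n (s\<lparr>reg := (reg s)(5 := ?x)\<rparr>) (Plus (Arr (3 + j) (Reg 4)) (Arr 2 (Reg 1))) = Some ?y"
    using Suc.prems(1-7) b(1,3) by simp_all
  ultimately show ?case
    unfolding merge_loop.simps by (intro wp_Seq wp_Assign) (simp_all del: aval.simps)
qed

section \<open>Loop invariants and the whole program\<close>

context parent_function
begin

text \<open>Entries \<open>Some j\<close> with \<open>j > k\<close> are not stored:
  \<open>merge\<close> computes the others without reading them. Tables of settled vertices above
  \<open>i\<close> are unconstrained.\<close>

definition represents :: "store \<Rightarrow> nat \<Rightarrow> (nat \<Rightarrow> nat option \<Rightarrow> enat) \<Rightarrow> bool" where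
  "represents s i f \<longleftrightarrow>
     (\<forall>v\<in>{1..i}. arr s 2 v = f v None \<and> (\<forall>j\<le>k. arr s (3 + j) v = f v (Some j)))"

definition merge_inv :: "store \<Rightarrow> bool" where
  "merge_inv s \<longleftrightarrow>
     (\<exists>i f. reg s 1 = enat i \<and> i \<in> {1..n} \<and> correct i f \<and> represents s i f \<and>
       (\<forall>c\<in>{2..n}. arr s 0 c = enat (p c) \<and> arr s 1 c = enat (c - 1)))"

definition init_inv :: "store \<Rightarrow> bool" where
  "init_inv s \<longleftrightarrow>
     (\<exists>i. reg s 0 = enat n \<and> reg s 1 = enat i \<and> i \<in> {1..n} \<and> represents s i (\<lambda>_. leaf) \<and>
       (\<forall>c\<in>{2..n}. arr s 0 c = enat (p c)) \<and> (\<forall>c\<in>{2..i}. arr s 1 c = enat (c - 1)))"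

lemma wp_init_step:
  assumes "init_inv s" "0 < n - the_enat (reg s 1)"
  shows "wp n (init_step k) s
    (\<lambda>s'. init_inv s' \<and> n - the_enat (reg s 1) = Suc (n - the_enat (reg s' 1)))"
proof -
  from assms obtain i where i: "reg s 0 = enat n" "reg s 1 = enat i" "1 \<le> i" "i < n"
    and rep: "represents s i (\<lambda>_. leaf)"
    and arrs: "\<forall>c\<in>{2..n}. arr s 0 c = enat (p c)" "\<forall>c\<in>{2..i}. arr s 1 c = enat (c - 1)"
    by (auto simp: init_inv_def)
  have [simp]: "enat i + 1 = enat (Suc i)" by (simp add: one_enat_def)
  have old: "arr s 2 v = 1" "arr s 3 v = 0" "j < k \<Longrightarrow> arr s (4 + j) v = \<infinity>" if "v \<in> {1..i}" for v j
  proof -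
    from rep that have *: "arr s 2 v = leaf None" "\<And>j. j \<le> k \<Longrightarrow> arr s (3 + j) v = leaf (Some j)"
      by (auto simp: represents_def)
    from *(1) *(2)[of 0] *(2)[of "Suc j"]
    show "arr s 2 v = 1" "arr s 3 v = 0" "j < k \<Longrightarrow> arr s (4 + j) v = \<infinity>"
      by (simp_all add: leaf_def)
  qed
  let ?s = "s\<lparr>arr := (arr s)(1 := (arr s 1)(Suc i := enat i)), reg := (reg s)(1 := enat (Suc i))\<rparr>"
  have "wp n (leaf_prog k) ?s
    (\<lambda>s'. init_inv s' \<and> n - the_enat (reg s 1) = Suc (n - the_enat (reg s' 1)))"
  proof (rule wp_leaf_prog)
    fix s' :: store
    assume reg: "reg s' = reg ?s" and arr: "\<And>a. arr s' a =
        (if a = 2 then (arr ?s a)(Suc i := 1)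
         else if a = 3 then (arr ?s a)(Suc i := 0)
         else if a \<in> {4..<4 + k} then (arr ?s a)(Suc i := \<infinity>) else arr ?s a)"
    have "represents s' (Suc i) (\<lambda>_. leaf)"
      unfolding represents_def
    proof (intro ballI conjI allI impI)
      fix v j
      assume v: "v \<in> {1..Suc i}"
      then show "arr s' 2 v = leaf None" by (auto simp: arr old leaf_def)
      assume "j \<le> k"
      with v show "arr s' (3 + j) v = leaf (Some j)"
        by (cases j) (auto simp: arr old leaf_def)
    qed
    moreover have "arr s' 0 c = enat (p c)" if "c \<in> {2..n}" for c
      using arrs(1) that by (simp add: arr)
    moreover have "arr s' 1 c = enat (c - 1)" if "c \<in> {2..Suc i}" for c
      using arrs(2) that by (auto simp: arr)
    ultimately have "init_inv s'"
      using i by (auto simp: init_inv_def reg)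
    then show "init_inv s' \<and> n - the_enat (reg s 1) = Suc (n - the_enat (reg s' 1))"
      using i by (auto simp: reg)
  qed (use i in auto)
  then show ?thesis
    using i unfolding init_step_def by (auto intro!: wp_Seq wp_Store wp_Assign)
qed

lemma wp_merge_prog:
  assumes "merge_inv s" "0 < the_enat (reg s 1) - 1"
  shows "wp n (merge_prog k) s
    (\<lambda>s'. merge_inv s' \<and> the_enat (reg s 1) - 1 = Suc (the_enat (reg s' 1) - 1))"
proof -
  from assms obtain i f where i: "reg s 1 = enat i" "i \<in> {2..n}"
    and f: "correct i f" and rep: "represents s i f"
    and arrs: "\<forall>c\<in>{2..n}. arr s 0 c = enat (p c) \<and> arr s 1 c = enat (c - 1)"
    by (auto simp: merge_inv_def)
  let ?v = "p i" and ?f' = "f(p i := merge (f (p i)) (f i))"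
  from p_range[OF i(2)] i(2) have pi: "1 \<le> ?v" "?v < i" "1 \<le> i" "i \<le> n" by auto
  have T: "arr s 2 v = f v None" "j \<le> k \<Longrightarrow> arr s (3 + j) v = f v (Some j)" if "v \<in> {1..i}" for v j
    using rep that by (auto simp: represents_def)
  let ?M = "INF l\<in>{1..k}. f i (Some l)"
  let ?G = "min (f i None) (INF l\<in>{..<k}. f i (Some l))"
  have b: "bounded_value n (f v x)" if "v \<in> {1..i}" for v x
    using correct_bounded[OF f pi(4) that] .
  have M: "bounded_value n ?M" and G: "bounded_value n ?G"
    using pi by (auto intro!: bounded_value_min bounded_value_INF b)
  \<comment> \<open>Parent and child are distinct roots at stage \<open>i\<close>, so their joint
    cost is \<infinity> or at most \<open>n\<close>.\<close>
  have add: "bounded_value n (f ?v x + f i y)" for x y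
    using pi by (intro correct_bounded_add[OF f]) auto
  \<comment> \<open>A sum with a minimum is a minimum of sums, each of which is bounded.\<close>
  have addM: "bounded_value n (f ?v x + ?M)" for x
    unfolding enat_INF_add_left[symmetric] by (intro bounded_value_INF add)
  let ?Q = "\<lambda>s'. merge_inv s' \<and> the_enat (reg s 1) - 1 = Suc (the_enat (reg s' 1) - 1)"
  let ?rest = "Seq (Store 3 (Reg 4) (Plus (Arr 3 (Reg 4)) (Reg 2)))
    (Seq (Store 2 (Reg 4) (Plus (Arr 2 (Reg 4)) (Reg 3))) (Assign 1 (Arr 1 (Reg 1))))"
  let ?s = "s\<lparr>reg := (reg s)(4 := enat ?v, 2 := ?M, 3 := ?G)\<rparr>"
  \<comment> \<open>The program is verified from its end to its beginning, each piece having the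
    remaining program as its postcondition.\<close>
  have loop: "wp n (merge_loop k) ?s (\<lambda>s'. wp n ?rest s' ?Q)"
  proof (rule wp_merge_loop[where i = i and v = ?v])
    fix s' :: store
    assume "\<And>r. r \<notin> {5, 6} \<Longrightarrow> reg s' r = reg ?s r"
      and arr': "\<And>a. arr s' a =
        (if a \<in> {4..<4 + k}
         then (arr ?s a)(?v := min (arr ?s a ?v + reg ?s 2) (arr ?s (a - 1) ?v + arr ?s 2 i))
         else arr ?s a)"
    then have reg': "reg s' 1 = enat i" "reg s' 2 = ?M" "reg s' 3 = ?G" "reg s' 4 = enat ?v"
      using i(1) by auto
    have arr_low: "arr s' a = arr s a" if "a < 4" for a
      using that by (simp add: arr')
    have arr_Suc: "arr s' (3 + Suc j) =
        (arr s (3 + Suc j))(?v := min (f ?v (Some (Suc j)) + ?M) (f ?v (Some j) + f i None))"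
      if "Suc j \<le> k" for j
      using T(2)[of ?v j] T(2)[of ?v "Suc j"] T(1)[of i] pi that by (simp add: arr')
    \<comment> \<open>No minimum is taken for \<open>Some 0\<close>: a selected child would make the
      parent's count positive, so the second alternative in \<open>merge_Some\<close> is
      \<infinity>.\<close>
    let ?s2 = "s'\<lparr>arr := (arr s')(3 := (arr s 3)(?v := f ?v (Some 0) + ?M),
      2 := (arr s 2)(?v := f ?v None + ?G)), reg := (reg s')(1 := enat (i - 1))\<rparr>"
    have "represents ?s2 (i - 1) ?f'"
      unfolding represents_def
    proof (intro ballI conjI allI impI)
      fix v j
      assume "v \<in> {1..i - 1}"
      then have v: "v \<in> {1..i}" by auto
      then show "arr ?s2 2 v = ?f' v None" using pi T(1)[of v] by (simp add: merge_None)
      assume "j \<le> k"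
      with v show "arr ?s2 (3 + j) v = ?f' v (Some j)"
        using pi T(2)[of v j] arr_Suc by (cases j) (simp_all add: merge_Some)
    qed
    then have "merge_inv ?s2"
      using correct_step[OF i(2) f] pi arrs i(2)
      by (auto simp: merge_inv_def arr_low intro!: exI[of _ "i - 1"])
    then have "?Q ?s2" using i by auto
    moreover have "arr s 2 ?v = f ?v None" "arr s 3 ?v = f ?v (Some 0)" "arr s 1 i = enat (i - 1)"
      using T(1)[of ?v] T(2)[of ?v 0] pi arrs i(2) by simp_all
    moreover have "bounded_value n (f ?v None)" "bounded_value n (f ?v (Some 0))"
      using b pi by simp_all
    ultimately show "wp n ?rest s' ?Q"
      using pi reg' M G by (auto intro!: wp_Seq wp_Store wp_Assign simp: arr_low)
  qed (use pi in \<open>simp_all add: i T b M add addM\<close>)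
  let ?rest2 = "Seq (Assign 3 (Arr 2 (Reg 1)))
    (Seq (min_prog 3 [0..<k]) (Seq (merge_loop k) ?rest))"
  let ?s1 = "s\<lparr>reg := (reg s)(4 := enat ?v, 2 := ?M)\<rparr>"
  have rest2: "wp n ?rest2 ?s1 ?Q"
  proof (intro wp_Seq wp_Assign)
    show "aval n ?s1 (Arr 2 (Reg 1)) = Some (f i None)"
      using i T(1)[of i] pi by simp
    show "wp n (min_prog 3 [0..<k]) (?s1\<lparr>reg := (reg ?s1)(3 := f i None)\<rparr>)
      (\<lambda>s. wp n (Seq (merge_loop k) ?rest) s ?Q)" (is "wp n _ ?s3 _")
    proof (rule wp_min_prog[where v = i])
      fix t :: store
      have "(INF l\<in>set [0..<k]. arr s (3 + l) i) = (INF l\<in>{..<k}. f i (Some l))"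
        using pi by (intro INF_cong) (auto simp: T(2))
      moreover assume "arr t = arr ?s3"
        "reg t = (reg ?s3)(3 := min (reg ?s3 3) (INF l\<in>set [0..<k]. arr ?s3 (3 + l) i))"
      ultimately have "t = ?s" by (intro store.equality) simp_all
      then show "wp n (Seq (merge_loop k) ?rest) t ?Q"
        using loop by (intro wp_Seq) simp
    next
      show "bounded_value n (arr ?s3 (3 + l) i)" if "l \<in> set [0..<k]" for l
        using that pi by (simp add: T b)
    qed (use i pi b in simp_all)
  qed
  show ?thesis
    unfolding merge_prog_def
  proof (intro wp_Seq wp_Assign)
    show "aval n s (Arr 0 (Reg 1)) = Some (enat ?v)"
      using i arrs by simp
    let ?s0 = "s\<lparr>reg := (reg s)(4 := enat ?v)\<rparr>"
    show "aval n ?s0 (Const \<infinity>) = Some \<infinity>" by simp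
    show "wp n (min_prog 2 [1..<Suc k]) (?s0\<lparr>reg := (reg ?s0)(2 := \<infinity>)\<rparr>) (\<lambda>s. wp n ?rest2 s ?Q)"
      (is "wp n _ ?s3 _")
    proof (rule wp_min_prog[where v = i])
      fix t :: store
      have "(INF l\<in>set [1..<Suc k]. arr s (3 + l) i) = ?M"
        using pi by (intro INF_cong) (auto simp: T(2))
      moreover assume "arr t = arr ?s3"
        "reg t = (reg ?s3)(2 := min (reg ?s3 2) (INF l\<in>set [1..<Suc k]. arr ?s3 (3 + l) i))"
      ultimately have "t = ?s1" by (intro store.equality) (simp_all add: min_def del: set_upt upt_Suc)
      then show "wp n ?rest2 t ?Q" using rest2 by simp
    next
      show "bounded_value n (arr ?s3 (3 + l) i)" if "l \<in> set [1..<Suc k]" for l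
        using that pi by (auto simp: T b)
    qed (use i pi b in simp_all)
  qed
qed

lemma qpd_prog_correct:
  assumes E: "E = (\<lambda>i. {i, p i}) ` {2..n}" and s: "input_store n p s"
  shows "\<exists>t s'. exec n (qpd_prog k) s t s' \<and>
    t \<le> max_cost (Assign 1 (Const 1)) + max_cost (leaf_prog k) + (3 + n * (3 + max_cost (init_step k))) +
      (3 + n * (3 + max_cost (merge_prog k))) + (3 + max_cost (min_prog 0 [1..<Suc k])) \<and>
    result s' = enat (quasiperfect_domination_number k {1..n} E)"
proof -
  have "wp n (Seq (Assign 1 (Const 1)) (leaf_prog k)) s init_inv"
  proof (intro wp_Seq wp_Assign)
    let ?s = "s\<lparr>reg := (reg s)(1 := 1)\<rparr>"
    show "wp n (leaf_prog k) ?s init_inv"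
    proof (rule wp_leaf_prog[where v = 1])
      fix s' :: store
      assume reg: "reg s' = reg ?s" and arr: "\<And>a. arr s' a =
        (if a = 2 then (arr ?s a)(1 := 1)
         else if a = 3 then (arr ?s a)(1 := 0)
         else if a \<in> {4..<4 + k} then (arr ?s a)(1 := \<infinity>) else arr ?s a)"
      have "arr s' (3 + j) 1 = leaf (Some j)" if "j \<le> k" for j
        using that by (cases j) (auto simp: arr leaf_def)
      then have "represents s' 1 (\<lambda>_. leaf)"
        by (simp add: represents_def arr leaf_def)
      then show "init_inv s'"
        using s n_pos by (auto simp: init_inv_def reg arr input_store_def one_enat_def intro!: exI[of _ 1])
    qed (use n_pos in \<open>auto simp: one_enat_def\<close>)
  qed simp
  from wp_loop_free_cost[OF this] obtain t1 s1 where 1: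
    "exec n (Seq (Assign 1 (Const 1)) (leaf_prog k)) s t1 s1"
    "t1 \<le> max_cost (Assign 1 (Const 1)) + max_cost (leaf_prog k)" "init_inv s1" by auto
  have "bval n s (Less (Reg 1) (Reg 0)) = Some (0 < n - the_enat (reg s 1))" if "init_inv s" for s
    using that by (auto simp: init_inv_def)
  from exec_While_cost[of "init_step k" init_inv n, OF _ this wp_init_step \<open>init_inv s1\<close>]
  obtain t2 s2 where 2: "exec n (While (Less (Reg 1) (Reg 0)) (init_step k)) s1 t2 s2"
    "t2 \<le> 3 + (n - the_enat (reg s1 1)) * (3 + max_cost (init_step k))"
    "init_inv s2" "n - the_enat (reg s2 1) = 0" by auto
  from 2(3) obtain i where i: "reg s2 1 = enat i" "i \<in> {1..n}" "represents s2 i (\<lambda>_. leaf)"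
    "\<forall>c\<in>{2..n}. arr s2 0 c = enat (p c)" "\<forall>c\<in>{2..i}. arr s2 1 c = enat (c - 1)"
    by (auto simp: init_inv_def)
  \<comment> \<open>On exit every vertex has the table \<open>leaf\<close>, which is correct for the
    forest without edges and so starts the second loop.\<close>
  moreover from i(1,2) 2(4) have "i = n" by simp
  ultimately have "merge_inv s2"
    unfolding merge_inv_def using correct_init by blast
  have "bval n s (Less (Const 1) (Reg 1)) = Some (0 < the_enat (reg s 1) - 1)" if "merge_inv s" for s
    using that n_pos by (auto simp: merge_inv_def one_enat_def)
  from exec_While_cost[of "merge_prog k" merge_inv n, OF _ this wp_merge_prog \<open>merge_inv s2\<close>]
  obtain t3 s3 where 3: "exec n (While (Less (Const 1) (Reg 1)) (merge_prog k)) s2 t3 s3"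
    "t3 \<le> 3 + (the_enat (reg s2 1) - 1) * (3 + max_cost (merge_prog k))"
    "merge_inv s3" "the_enat (reg s3 1) - 1 = 0" by auto
  from 3(3) obtain i f where i_f: "reg s3 1 = enat i" "i \<in> {1..n}" "correct i f" "represents s3 i f"
    by (auto simp: merge_inv_def)
  moreover from i_f(1,2) 3(4) have "i = 1" by simp
  ultimately have f: "correct 1 f" "represents s3 1 f" "reg s3 1 = enat 1" by simp_all
  have "wp n (Seq (Assign 0 (Arr 2 (Reg 1))) (min_prog 0 [1..<Suc k])) s3
      (\<lambda>s'. result s' = enat (quasiperfect_domination_number k {1..n} E))"
  proof (intro wp_Seq wp_Assign)
    have bounded: "bounded_value n (f 1 x)" for x
      using correct_bounded[OF f(1) n_pos] by simp
    have T: "arr s3 2 1 = f 1 None" "j \<le> k \<Longrightarrow> arr s3 (3 + j) 1 = f 1 (Some j)" for j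
      using f(2) by (auto simp: represents_def)
    show "aval n s3 (Arr 2 (Reg 1)) = Some (f 1 None)"
      using f(3) n_pos T(1) by simp
    let ?s = "s3\<lparr>reg := (reg s3)(0 := f 1 None)\<rparr>"
    show "wp n (min_prog 0 [1..<Suc k]) ?s
      (\<lambda>s'. result s' = enat (quasiperfect_domination_number k {1..n} E))"
    proof (rule wp_min_prog[where v = 1])
      fix s' :: store
      assume "reg s' = (reg ?s)(0 := min (reg ?s 0) (INF l\<in>set [1..<Suc k]. arr ?s (3 + l) 1))"
      then have "result s' = min (f 1 None) (INF l\<in>{1..<Suc k}. arr s3 (3 + l) 1)"
        unfolding set_upt by (simp add: result_def)
      also have "(INF l\<in>{1..<Suc k}. arr s3 (3 + l) 1) = (INF l\<in>{1..k}. f 1 (Some l))"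
        using T(2) by (intro INF_cong) auto
      finally show "result s' = enat (quasiperfect_domination_number k {1..n} E)"
        using quasiperfect_domination_number_eq[OF E f(1)] by simp
    qed (use f(3) n_pos T(2) bounded in auto)
  qed
  from wp_loop_free_cost[OF this] obtain t4 s4 where 4:
    "exec n (Seq (Assign 0 (Arr 2 (Reg 1))) (min_prog 0 [1..<Suc k])) s3 t4 s4"
    "t4 \<le> 3 + max_cost (min_prog 0 [1..<Suc k])"
    "result s4 = enat (quasiperfect_domination_number k {1..n} E)" by auto
  have "exec n (qpd_prog k) s (t1 + (t2 + (t3 + t4))) s4"
    unfolding qpd_prog_def using 1 2 3 4 by (intro exec.Seq)
  moreover have "the_enat (reg s2 1) - 1 \<le> n"
    using \<open>merge_inv s2\<close> by (auto simp: merge_inv_def)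
  then have "(the_enat (reg s2 1) - 1) * (3 + max_cost (merge_prog k)) \<le> n * (3 + max_cost (merge_prog k))"
    by (rule mult_le_mono1)
  moreover have "(n - the_enat (reg s1 1)) * (3 + max_cost (init_step k)) \<le> n * (3 + max_cost (init_step k))"
    by (intro mult_le_mono1) simp
  ultimately show ?thesis using 1 2 3 4
    by (intro exI[of _ "t1 + (t2 + (t3 + t4))"] exI[of _ s4]) linarith
qed

end

theorem theorem5:
  fixes k :: nat
  assumes "k \<ge> 1"
  shows "\<exists>(P :: com) (T :: nat \<Rightarrow> nat).
    (\<lambda>n. real (T n)) \<in> O(\<lambda>n. real n) \<and>
    (\<forall>(n :: nat) (E :: nat set set) (Parent :: nat \<Rightarrow> nat) (s :: store).
      tree {1..n} E \<longrightarrow> parent_array n E Parent \<longrightarrow> input_store n Parent s \<longrightarrow>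
      (\<exists>t s'. exec n P s t s' \<and> t \<le> T n \<and>
        result s' = enat (quasiperfect_domination_number k {1..n} E)))"
proof -
  \<comment> \<open>The bound is split into a constant and a coefficient of \<open>n\<close>: 9
    collects the two failing guard tests and the assignment to register 0, 6 the guard tests per
    iteration of the two loops.\<close>
  define a b where "a = max_cost (Assign 1 (Const 1)) + max_cost (leaf_prog k) + 9 + max_cost (min_prog 0 [1..<Suc k])"
    and "b = 6 + max_cost (init_step k) + max_cost (merge_prog k)"
  let ?T = "\<lambda>n. a + n * b"
  have "(\<lambda>n. real (?T n)) \<in> O(\<lambda>n. real n)"
  proof (rule bigoI[of _ "real (a + b)"], rule eventually_sequentiallyI[of 1])
    fix n :: nat
    assume "1 \<le> n"
    then have "?T n \<le> (a + b) * n" by (simp add: algebra_simps)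
    then have "real (?T n) \<le> real ((a + b) * n)" by (rule of_nat_mono)
    then show "norm (real (?T n)) \<le> real (a + b) * norm (real n)" by simp
  qed
  moreover have "\<exists>t s'. exec n (qpd_prog k) s t s' \<and> t \<le> ?T n \<and>
      result s' = enat (quasiperfect_domination_number k {1..n} E)"
    if tree: "tree {1..n} E" and par: "parent_array n E Parent" and inp: "input_store n Parent s"
    for n E Parent s
  proof -
    \<comment> \<open>A connected graph has a nonempty vertex set by definition.\<close>
    have "1 \<le> n" using tree by (cases n) (auto simp: tree_def connected_graph_def)
    then interpret parent_function n k Parent
      using tree_edges_eq(1)[OF tree par] by unfold_locales auto
    obtain t s' where "exec n (qpd_prog k) s t s'"
      "t \<le> max_cost (Assign 1 (Const 1)) + max_cost (leaf_prog k) + (3 + n * (3 + max_cost (init_step k))) +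
        (3 + n * (3 + max_cost (merge_prog k))) + (3 + max_cost (min_prog 0 [1..<Suc k]))"
      "result s' = enat (quasiperfect_domination_number k {1..n} E)"
      using qpd_prog_correct[OF tree_edges_eq(2)[OF tree par] inp] by blast
    then show ?thesis
      by (intro exI[of _ t] exI[of _ s']) (simp add: a_def b_def algebra_simps)
  qed
  ultimately show ?thesis
    by (intro exI[of _ "qpd_prog k"] exI[of _ "\<lambda>n. a + n * b"]) blast
qed

end
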